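(* Let $\Omega\subset\mathbb R^d$ be a regular set with $\mu_d(\Omega)>0$ that is connected and contained in the closure of its interior, and let $f:\Omega\to\mathbb R$ be continuous a.e. on $\Omega$. Let $[\boldsymbol a,\boldsymbol b]$ be any $d$-dimensional rectangle containing $\Omega$ and let $\mathcal G_{\boldsymbol n}=\{\boldsymbol x_{\boldsymbol i,\boldsymbol n}\}_{\boldsymbol i=\mathbf 1,\ldots,\boldsymbol n}$ ($\boldsymbol n\in\mathbb N^d$) be any asymptotically uniform grid in $[\boldsymbol a,\boldsymbol b]$. For each $\boldsymbol n\in\mathbb N^d$, sort the samples $f(\boldsymbol x_{\boldsymbol i,\boldsymbol n})$, $\boldsymbol i\in\mathcal I_{\boldsymbol n}(\Omega)=\{\boldsymbol i\in\{\mathbf 1,\ldots,\boldsymbol n\}:\boldsymbol x_{\boldsymbol i,\boldsymbol n}\in\Omega\}$, (with multiplicity) in non-decreasing order into a vector $(s_0,\ldots,s_{\omega(\boldsymbol n)})$, where $\omega(\boldsymbol n)=\#\mathcal I_{\boldsymbol n}(\Omega)-1$, and let $f^\dag_{\boldsymbol n}:[0,1]\to\mathbb R$ be the linear spline function that interpolates $(s_0,\ldots,s_{\omega(\boldsymbol n)})$ over the equally spaced nodes $(0,\frac1{\omega(\boldsymbol n)},\frac2{\omega(\boldsymbol n)},\ldots,1)$. Then the following properties hold (all limits as $\boldsymbol n\to\infty$). 1. If $f$ is continuous on $\Omega$, then $f^\dag_{\boldsymbol n}\to f^\dag$ uniformly on every compact interval $[\alpha,\beta]\subset(0,1)$. 2.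 If $f$ is continuous and bounded from below on $\Omega$, then $f^\dag_{\boldsymbol n}\to f^\dag$ uniformly on every compact interval $[0,\alpha]\subset[0,1)$. 3. If $f$ is continuous and bounded from above on $\Omega$, then $f^\dag_{\boldsymbol n}\to f^\dag$ uniformly on every compact interval $[\alpha,1]\subset(0,1]$. 4. If $f$ is continuous and bounded on $\Omega$, then $f^\dag_{\boldsymbol n}\to f^\dag$ uniformly on $[0,1]$.
   Context: $\mu_d$ is Lebesgue measure in $\mathbb R^d$; all measure-theoretic terms refer to it. $\mathbb N=\{1,2,\ldots\}$. Regular set: $\Omega\subset\mathbb R^d$ is regular if it is bounded and $\mu_d(\partial\Omega)=0$. Monotone rearrangement: for $f:\Omega\to\mathbb R$ measurable with $0<\mu_d(\Omega)<\infty$, $f^\dag:(0,1)\to\mathbb R$ is $f^\dag(y)=\inf\{u\in\mathbb R:\mu_d\{\boldsymbol x\in\Omega:f(\boldsymbol x)\le u\}/\mu_d(\Omega)\ge y\}$; it is non-decreasing. If $f$ is bounded from below, $f^\dag$ is extended to $y=0$ by $f^\dag(0)=\lim_{y\to0}f^\dag(y)\in\mathbb R$; if $f$ is bounded from above, $f^\dag$ is extended to $y=1$ by $f^\dag(1)=\lim_{y\to1}f^\dag(y)\in\mathbb R$. Multi-indices: inequalities and operations (product, quotient) between vectors are componentwise; $\mathbf 1=(1,\ldots,1)$; $\{\mathbf 1,\ldots,\boldsymbol n\}=\{\boldsymbol i\in\mathbb Z^d:\mathbf 1\le\boldsymbol i\le\boldsymbol n\}$; $\boldsymbol n\to\infty$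 means $\min_j n_j\to\infty$. Rectangles: for $\boldsymbol a\le\boldsymbol b$ in $\mathbb R^d$, $[\boldsymbol a,\boldsymbol b]=[a_1,b_1]\times\cdots\times[a_d,b_d]$. Asymptotically uniform grid: a family, indexed by $\boldsymbol n\in\mathbb N^d$, of grids $\mathcal G_{\boldsymbol n}=\{\boldsymbol x_{\boldsymbol i,\boldsymbol n}\}_{\boldsymbol i=\mathbf 1,\ldots,\boldsymbol n}$ of points in $\mathbb R^d$ is asymptotically uniform in $[\boldsymbol a,\boldsymbol b]$ if \[ \lim_{\boldsymbol n\to\infty}\max_{\boldsymbol i=\mathbf 1,\ldots,\boldsymbol n}\Bigl\|\boldsymbol x_{\boldsymbol i,\boldsymbol n}-\Bigl(\boldsymbol a+\boldsymbol i\,\frac{\boldsymbol b-\boldsymbol a}{\boldsymbol n}\Bigr)\Bigr\|_\infty=0. \] Linear spline: $f^\dag_{\boldsymbol n}(i/\omega(\boldsymbol n))=s_i$ for $i=0,\ldots,\omega(\boldsymbol n)$ and $f^\dag_{\boldsymbol n}$ is affine on each $[\frac i{\omega(\boldsymbol n)},\frac{i+1}{\omega(\boldsymbol n)}]$. It is defined when $\omega(\boldsymbol n)\ge1$, which holds whenever $\min_j n_j$ is sufficiently large; $f^\dag_{\boldsymbol n}$ may be taken arbitrary for the other $\boldsymbol n$. *)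

theory Defs
  imports "HOL-Analysis.Analysis"
begin

definition regular_set :: "(real ^ 'd) set \<Rightarrow> bool" where
  "regular_set \<Omega> \<longleftrightarrow> bounded \<Omega> \<and> frontier \<Omega> \<in> null_sets lebesgue"

definition continuous_ae_on :: "(real ^ 'd) set \<Rightarrow> (real ^ 'd \<Rightarrow> real) \<Rightarrow> bool" where
  "continuous_ae_on \<Omega> f \<longleftrightarrow>
     (AE x in lebesgue. x \<in> \<Omega> \<longrightarrow> continuous (at x within \<Omega>) f)"

definition rearr_open :: "(real ^ 'd) set \<Rightarrow> (real ^ 'd \<Rightarrow> real) \<Rightarrow> real \<Rightarrow> real" where
  "rearr_open \<Omega> f y =
     Inf {u. measure lebesgue {x \<in> \<Omega>. f x \<le> u} / measure lebesgue \<Omega> \<ge> y}"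

text \<open>The values at 0 and 1 are meaningful only if the function is bounded from below, respectively
  from above, on the domain; otherwise the limit need not exist and \<^const>\<open>Lim\<close> is
  unspecified.\<close>

definition monotone_rearrangement ::
  "(real ^ 'd) set \<Rightarrow> (real ^ 'd \<Rightarrow> real) \<Rightarrow> real \<Rightarrow> real" where
  "monotone_rearrangement \<Omega> f y =
     (if y = 0 then Lim (at_right 0) (rearr_open \<Omega> f)
      else if y = 1 then Lim (at_left 1) (rearr_open \<Omega> f)
      else rearr_open \<Omega> f y)"

text \<open>Multi-indices are vectors of type \<^typ>\<open>nat ^ 'd\<close> with the componentwise order, so that
  \<open>{1..n}\<close> is the set of multi-indices between the all-ones vector and \<open>n\<close>. Vectors \<open>n\<close> with a zero
  component are irrelevant along the following filter, which expresses that the minimal component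
  tends to infinity.\<close>

definition multi_at_top :: "(nat ^ 'd) filter" where
  "multi_at_top = filtercomap (\<lambda>n. Min (range (\<lambda>j. n $ j))) at_top"

text \<open>A family of grids is a function \<open>x\<close>, where \<open>x n i\<close> is the point with index \<open>i\<close> of the grid
  with index \<open>n\<close>; only its values for \<open>i \<in> {1..n}\<close> are used.\<close>

definition asymptotically_uniform_grid ::
  "real ^ 'd \<Rightarrow> real ^ 'd \<Rightarrow> (nat ^ 'd \<Rightarrow> nat ^ 'd \<Rightarrow> real ^ 'd) \<Rightarrow> bool" where
  "asymptotically_uniform_grid a b x \<longleftrightarrow>
     ((\<lambda>n. Max ((\<lambda>i. infnorm (x n i -
          (\<chi> j. a $ j + real (i $ j) * ((b $ j - a $ j) / real (n $ j))))) ` {1..n}))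
       \<longlongrightarrow> 0) multi_at_top"

definition grid_indices ::
  "(real ^ 'd) set \<Rightarrow> (nat ^ 'd \<Rightarrow> nat ^ 'd \<Rightarrow> real ^ 'd) \<Rightarrow> nat ^ 'd \<Rightarrow> (nat ^ 'd) set" where
  "grid_indices \<Omega> x n = {i \<in> {1..n}. x n i \<in> \<Omega>}"

definition sorted_samples ::
  "(real ^ 'd) set \<Rightarrow> (real ^ 'd \<Rightarrow> real) \<Rightarrow> (nat ^ 'd \<Rightarrow> nat ^ 'd \<Rightarrow> real ^ 'd) \<Rightarrow> nat ^ 'd \<Rightarrow> real list"
  where
  "sorted_samples \<Omega> f x n =
     sorted_list_of_multiset (image_mset (\<lambda>i. f (x n i)) (mset_set (grid_indices \<Omega> x n)))"

text \<open>Truncated subtraction gives 0 instead of -1 if no grid point lies in the domain; the spline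
  is constrained only if the value is at least 1.\<close>

definition omega ::
  "(real ^ 'd) set \<Rightarrow> (nat ^ 'd \<Rightarrow> nat ^ 'd \<Rightarrow> real ^ 'd) \<Rightarrow> nat ^ 'd \<Rightarrow> nat" where
  "omega \<Omega> x n = card (grid_indices \<Omega> x n) - 1"

definition is_linear_spline :: "nat \<Rightarrow> real list \<Rightarrow> (real \<Rightarrow> real) \<Rightarrow> bool" where
  "is_linear_spline m s g \<longleftrightarrow>
     (\<forall>i\<le>m. g (real i / real m) = s ! i) \<and>
     (\<forall>i<m. \<exists>p q. \<forall>y\<in>{real i / real m..real (i + 1) / real m}. g y = p * y + q)"

end

theory Submission
  imports Defs
begin

text \<open>
  If \<open>V\<close> is open and \<open>K \<subseteq> V\<close> is compact, then for a fine grid every cell meeting \<open>K\<close> has its grid point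
  in \<open>V\<close>, so asymptotically at least the share \<open>\<mu>(V)\<close> of the grid points lies in \<open>V\<close>. Applied to the
  complement of the closure of \<open>\<Omega>\<close> this also bounds the number of grid points in \<open>\<Omega>\<close> from above.
  Hence the proportions of samples below and above a level are asymptotically at least the
  normalised measures of \<open>{f < c}\<close> and \<open>{f > c}\<close>, which squeezes the sorted samples around the
  quantiles of \<open>f\<close>, provided that \<open>{f < c}\<close> has normalised measure greater than \<open>y\<close> for every \<open>c\<close> above
  the \<open>y\<close>-quantile. This holds because \<open>f\<close> takes every intermediate value on the connected
  set \<open>\<Omega>\<close>, and the preimage of an open set of values, if nonempty, meets the interior of \<open>\<Omega>\<close> in a
  nonempty open set. The same fact makes the rearrangement continuous, and pointwise convergence of
  monotone functions to a continuous limit on a compact interval is uniform.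
\<close>

section \<open>Counting grid points\<close>

lemma eventually_multi_at_top:
  "eventually P (multi_at_top :: (nat ^ 'd) filter) \<longleftrightarrow> (\<exists>N. \<forall>n. (\<forall>j. N \<le> n $ j) \<longrightarrow> P n)"
  unfolding multi_at_top_def eventually_filtercomap_at_top_linorder
  by simp

lemma eventually_multi_at_top_component_ge:
  "eventually (\<lambda>n. \<forall>j. N \<le> n $ j) (multi_at_top :: (nat ^ 'd) filter)"
  unfolding eventually_multi_at_top by blast

text \<open>Identifies boxes of multi-indices with extensional function spaces, from which
  finiteness and cardinality are inherited.\<close>

lemma bij_betw_vec_nth_atLeastAtMost:
  "bij_betw vec_nth {m..n :: nat ^ 'd} (\<Pi>\<^sub>E j\<in>UNIV. {m $ j..n $ j})"
  by (rule bij_betw_byWitness[where f' = vec_lambda])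
     (auto simp: less_eq_vec_def PiE_iff)

lemma finite_atLeastAtMost_vec [simp]: "finite {m..n :: nat ^ 'd}"
  using bij_betw_finite[OF bij_betw_vec_nth_atLeastAtMost[of m n]]
  by (simp add: finite_PiE)

lemma finite_grid_indices [simp]: "finite (grid_indices \<Omega> x n)"
  by (rule finite_subset[of _ "{1..n}"]) (auto simp: grid_indices_def)

lemma card_atLeastAtMost_one_vec: "card {1..n :: nat ^ 'd} = (\<Prod>j\<in>UNIV. n $ j)"
  using bij_betw_same_card[OF bij_betw_vec_nth_atLeastAtMost[of 1 n]]
  by (simp add: card_PiE)

text \<open>The cells have the nodes of the exactly uniform grid as upper corners. In each
  coordinate the index is the ceiling of the position measured in cell widths.\<close>

lemma uniform_grid_cells_cover:
  fixes a b y :: "real ^ 'd" and n :: "nat ^ 'd"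
  assumes y: "y \<in> cbox a b" and ab: "\<And>j. a $ j < b $ j" and n: "\<And>j. 0 < n $ j"
  shows "\<exists>i\<in>{1..n}. y \<in> cbox (\<chi> j. a $ j + (real (i $ j) - 1) * ((b $ j - a $ j) / real (n $ j)))
                               (\<chi> j. a $ j + real (i $ j) * ((b $ j - a $ j) / real (n $ j)))"
proof -
  have "\<exists>k. 1 \<le> k \<and> k \<le> n $ j \<and> a $ j + (real k - 1) * ((b $ j - a $ j) / real (n $ j)) \<le> y $ j
      \<and> y $ j \<le> a $ j + real k * ((b $ j - a $ j) / real (n $ j))" for j
  proof -
    define h where "h = (b $ j - a $ j) / real (n $ j)"
    define t where "t = (y $ j - a $ j) / h"
    have h: "0 < h" using ab[of j] n[of j] by (simp add: h_def)
    have yj: "a $ j \<le> y $ j" "y $ j \<le> b $ j" using y by (auto simp: mem_box_cart)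
    have yt: "y $ j = a $ j + t * h" using h by (simp add: t_def)
    have t0: "0 \<le> t" using yj h by (simp add: t_def)
    have "b $ j - a $ j = real (n $ j) * h" using n[of j] by (simp add: h_def)
    then have "t * h \<le> real (n $ j) * h" using yj yt by simp
    then have tn: "t \<le> real (n $ j)" using h by simp
    \<comment> \<open>On the lower face \<open>t = 0\<close> and the ceiling is 0, which is not an
      index; \<open>max 1\<close> puts such points into the first cell.\<close>
    define k where "k = max 1 (nat \<lceil>t\<rceil>)"
    have "1 \<le> k" by (simp add: k_def)
    moreover have "k \<le> n $ j" using tn n[of j] t0 by (auto simp: k_def nat_le_iff ceiling_le_iff)
    moreover have "real k - 1 \<le> t" using t0 unfolding k_def by linarith
    moreover have "t \<le> real k" unfolding k_def by linarith
    ultimately show ?thesis using h unfolding yt h_def[symmetric]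
      by (intro exI[of _ k]) (simp add: mult_right_mono)
  qed
  then obtain i where "\<And>j. 1 \<le> i j \<and> i j \<le> n $ j
      \<and> a $ j + (real (i j) - 1) * ((b $ j - a $ j) / real (n $ j)) \<le> y $ j
      \<and> y $ j \<le> a $ j + real (i j) * ((b $ j - a $ j) / real (n $ j))" by metis
  then show ?thesis
    by (intro bexI[of _ "vec_lambda i"]) (simp_all add: mem_box_cart less_eq_vec_def)
qed

text \<open>All cells have equal volume, so covering a set by cells bounds its measure by a multiple
  of their number.\<close>

lemma content_uniform_grid_cell:
  fixes a b :: "real ^ 'd" and n i :: "nat ^ 'd"
  assumes ab: "\<And>j. a $ j < b $ j" and n: "\<And>j. 0 < n $ j"
  shows "measure lborel (cbox (\<chi> j. a $ j + (real (i $ j) - 1) * ((b $ j - a $ j) / real (n $ j)))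
                       (\<chi> j. a $ j + real (i $ j) * ((b $ j - a $ j) / real (n $ j))))
       = measure lborel (cbox a b) / real (card {1..n})"
proof -
  define h where "h j = (b $ j - a $ j) / real (n $ j)" for j
  have h: "0 < h j" for j using ab[of j] n[of j] by (simp add: h_def)
  have "cbox a b \<noteq> {}" using ab by (simp add: interval_ne_empty_cart less_imp_le)
  moreover have "cbox (\<chi> j. a $ j + (real (i $ j) - 1) * h j) (\<chi> j. a $ j + real (i $ j) * h j) \<noteq> {}"
    using h by (simp add: interval_ne_empty_cart mult_right_mono less_imp_le)
  ultimately show ?thesis unfolding h_def[symmetric]
    by (simp add: content_cbox_cart card_atLeastAtMost_one_vec prod_dividef[symmetric] h_def[symmetric]
        algebra_simps)
qed

text \<open>Lebesgue sets are approximated from inside by closed sets; boundedness of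
  \<open>S\<close> makes these compact.\<close>

lemma lmeasurable_inner_compact:
  fixes S :: "'a::euclidean_space set"
  assumes S: "S \<in> lmeasurable" "bounded S" and c: "c < measure lebesgue S"
  obtains K where "compact K" "K \<subseteq> S" "c < measure lebesgue K"
proof -
  obtain K where K: "closed K" "K \<subseteq> S" "S - K \<in> lmeasurable"
      "emeasure lebesgue (S - K) < ennreal (measure lebesgue S - c)"
    using sets_lebesgue_inner_closed[of S "measure lebesgue S - c"] S c by (auto simp: fmeasurableD)
  have "compact K" using K(1,2) S(2) bounded_subset compact_eq_bounded_closed by blast
  then have "measure lebesgue (S - K) = measure lebesgue S - measure lebesgue K"
    using K(2) S(1) by (simp add: measurable_measure_Diff lmeasurable_compact fmeasurableD)
  moreover have "measure lebesgue (S - K) < measure lebesgue S - c"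
    using K(3,4) c by (simp add: emeasure_eq_measure2 ennreal_less_iff)
  ultimately show ?thesis using that \<open>compact K\<close> K(2) by auto
qed

text \<open>\<open>K\<close> is a compact part of \<open>V \<inter> cbox a b\<close> still of
  measure above \<open>c\<close>. The cells whose grid point lies in \<open>V\<close> cover it, so
  their total volume exceeds \<open>c\<close>.\<close>

lemma card_grid_indices_open_gt:
  fixes a b :: "real ^ 'd"
  assumes grid: "asymptotically_uniform_grid a b x" and ab: "\<And>j. a $ j < b $ j"
    and V: "open V" and c: "c < measure lebesgue (V \<inter> cbox a b)"
  shows "eventually (\<lambda>n. c < measure lborel (cbox a b) / real (card {1..n}) * real (card (grid_indices V x n)))
           multi_at_top"
proof -
  have "V \<inter> cbox a b \<in> lmeasurable"
    using V by (intro bounded_set_imp_lmeasurable) (auto intro: bounded_Int)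
  then obtain K where K: "compact K" "K \<subseteq> V \<inter> cbox a b" "c < measure lebesgue K"
    using lmeasurable_inner_compact c by (metis bounded_Int bounded_cbox)
  obtain \<delta> where \<delta>: "\<delta> > 0" "\<And>p q. p \<in> K \<Longrightarrow> q \<notin> V \<Longrightarrow> \<delta> \<le> dist p q"
  proof -
    have "K \<inter> - V = {}" using K(2) by blast
    then show ?thesis
      using separate_compact_closed[of K "- V"] K(1) V that by (metis ComplI closed_Compl)
  qed
  \<comment> \<open>A point of a cell and the grid point of that cell differ by less than
    \<open>2 * \<eta>\<close> in each coordinate, one \<eta> for the cell width and one for the
    displacement of the grid point. Summing over the \<open>CARD('d)\<close> coordinates gives
    \<delta>.\<close>
  define \<eta> where "\<eta> = \<delta> / (2 * real CARD('d))"
  have \<eta>: "\<eta> > 0" using \<delta> by (simp add: \<eta>_def)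
  define node where
    "node n i = (\<chi> j. a $ j + real (i $ j) * ((b $ j - a $ j) / real (n $ j)))" for n i :: "nat ^ 'd"
  define cell where
    "cell n i = cbox (\<chi> j. a $ j + (real (i $ j) - 1) * ((b $ j - a $ j) / real (n $ j))) (node n i)"
    for n i :: "nat ^ 'd"
  have ev1: "eventually (\<lambda>n. Max ((\<lambda>i. infnorm (x n i - node n i)) ` {1..n}) < \<eta>) multi_at_top"
    using order_tendstoD(2)[OF grid[unfolded asymptotically_uniform_grid_def] \<eta>]
    by (simp add: node_def)
  \<comment> \<open>Once all components of \<open>n\<close> are at least \<open>N\<close>, the cells
    have sides shorter than \<eta>.\<close>
  obtain N where N: "\<And>j. (b $ j - a $ j) / \<eta> < real N"
  proof -
    obtain N where "Max (range (\<lambda>j. (b $ j - a $ j) / \<eta>)) < real N"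
      using reals_Archimedean2 by blast
    then show ?thesis by (intro that[of N]) simp
  qed
  show ?thesis
    using ev1 eventually_multi_at_top_component_ge[of "max 1 N"]
  proof eventually_elim
    case (elim n)
    have n: "0 < n $ j" for j using elim(2) by (metis max.boundedE not_one_le_zero gr0I)
    have h: "(b $ j - a $ j) / real (n $ j) < \<eta>" for j
    proof -
      have "(b $ j - a $ j) / \<eta> < real (n $ j)"
        using N[of j] elim(2) by (meson less_le_trans max.boundedE of_nat_le_iff)
      then show ?thesis using n[of j] \<eta> by (simp add: field_simps)
    qed
    have K_cover: "K \<subseteq> (\<Union>i\<in>grid_indices V x n. cell n i)"
    proof
      fix y assume y: "y \<in> K"
      then obtain i where i: "i \<in> {1..n}" "y \<in> cell n i"
        using uniform_grid_cells_cover[of y a b n] K(2) ab n unfolding cell_def node_def by blast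
      have "infnorm (x n i - node n i) < \<eta>"
        using elim(1) i(1) by (subst (asm) Max_less_iff) auto
      then have x_node: "\<bar>(x n i - node n i) $ j\<bar> < \<eta>" for j
        using component_le_infnorm_cart[of "x n i - node n i" j] by linarith
      have "\<bar>(x n i - y) $ j\<bar> < 2 * \<eta>" for j
      proof -
        have "node n i $ j - (b $ j - a $ j) / real (n $ j) \<le> y $ j" "y $ j \<le> node n i $ j"
          using i(2)
          by (auto simp: cell_def node_def mem_box_cart left_diff_distrib add_diff_eq
              simp del: times_divide_eq_right times_divide_eq_left)
        then show ?thesis using x_node[of j] h[of j] by simp
      qed
      then have "(\<Sum>j\<in>UNIV. \<bar>(x n i - y) $ j\<bar>) < (\<Sum>j\<in>(UNIV::'d set). 2 * \<eta>)"
        by (intro sum_strict_mono) auto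
      also have "\<dots> = \<delta>" by (simp add: \<eta>_def)
      finally have "dist y (x n i) < \<delta>"
        using norm_le_l1_cart[of "x n i - y"] by (simp add: dist_norm norm_minus_commute)
      then have "x n i \<in> V" using \<delta>(2)[OF y] by force
      then show "y \<in> (\<Union>i\<in>grid_indices V x n. cell n i)"
        using i by (auto simp: grid_indices_def)
    qed
    have "measure lebesgue K \<le> measure lebesgue (\<Union>i\<in>grid_indices V x n. cell n i)"
      using K_cover K(1) by (intro measure_mono_fmeasurable fmeasurable.finite_UN)
        (auto simp: cell_def lmeasurable_compact fmeasurableD)
    also have "\<dots> \<le> (\<Sum>i\<in>grid_indices V x n. measure lebesgue (cell n i))"
      by (intro measure_UNION_le) (auto simp: cell_def)
    also have "\<dots> = (\<Sum>i\<in>grid_indices V x n. measure lborel (cbox a b) / real (card {1..n}))"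
      using content_uniform_grid_cell[OF ab n] by (intro sum.cong) (simp_all add: cell_def node_def)
    finally show ?case using K(3) by (simp add: mult.commute)
  qed
qed

section \<open>Monotone functions and sorted samples\<close>

text \<open>On a finite mesh the convergence is uniform. Between neighbouring mesh points
  monotonicity traps \<open>F n y\<close>, and uniform continuity keeps \<open>g\<close> within
  \<open>e / 2\<close> of its values there.\<close>

lemma uniform_limit_mono_on:
  fixes F :: "'a \<Rightarrow> real \<Rightarrow> real"
  assumes mono: "eventually (\<lambda>n. mono_on {u..v} (F n)) L"
    and cont: "continuous_on {u..v} g"
    and lim: "\<And>y. y \<in> {u..v} \<Longrightarrow> ((\<lambda>n. F n y) \<longlongrightarrow> g y) L"
  shows "uniform_limit {u..v} F g L"
proof (cases "u \<le> v")
  case True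
  show ?thesis
  proof (rule uniform_limitI)
    fix e :: real assume e: "e > 0"
    have "uniformly_continuous_on {u..v} g"
      using cont by (rule compact_uniformly_continuous) simp
    then obtain d where d: "d > 0"
        "\<And>y z. y \<in> {u..v} \<Longrightarrow> z \<in> {u..v} \<Longrightarrow> dist z y < d \<Longrightarrow> dist (g z) (g y) < e / 2"
      unfolding uniformly_continuous_on_def using e half_gt_zero by metis
    obtain m :: nat where m: "(v - u) / d < real m" using reals_Archimedean2 by blast
    have m0: "m > 0" using m True d(1) by (metis divide_nonneg_pos diff_ge_0_iff_ge gr0I not_less of_nat_0)
    define p where "p k = u + real k * ((v - u) / real m)" for k
    have step: "(v - u) / real m < d" using m m0 d(1) by (simp add: field_simps)
    have p: "p k \<in> {u..v}" if "k \<le> m" for k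
    proof -
      have "real k * ((v - u) / real m) \<le> real m * ((v - u) / real m)"
        using that True by (intro mult_right_mono) auto
      then show ?thesis using True m0 by (simp add: p_def)
    qed
    have "eventually (\<lambda>n. \<forall>k\<in>{..m}. dist (F n (p k)) (g (p k)) < e / 2) L"
      using lim p e by (intro eventually_ball_finite ballI tendstoD[where e = "e / 2"]) simp_all
    with mono show "eventually (\<lambda>n. \<forall>y\<in>{u..v}. dist (F n y) (g y) < e) L"
    proof eventually_elim
      case (elim n)
      show ?case
      proof
        fix y assume y: "y \<in> {u..v}"
        \<comment> \<open>At \<open>y = v\<close> the floor used otherwise would be
          \<open>m\<close>, one index too far; this case also covers the degenerate interval
          \<open>u = v\<close>.\<close>
        have "\<exists>k<m. p k \<le> y \<and> y \<le> p (Suc k)"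
        proof (cases "y = v")
          case True
          then show ?thesis using m0 p[of "m - 1"] by (intro exI[of _ "m - 1"]) (auto simp: p_def)
        next
          case False
          define t where "t = (y - u) * real m / (v - u)"
          have uv: "u < v" using False y by auto
          have t: "0 \<le> t" "t < real m" using y False uv m0 by (auto simp: t_def field_simps)
          have yt: "y = u + t * ((v - u) / real m)" using uv m0 by (simp add: t_def)
          have "nat \<lfloor>t\<rfloor> < m" using t by linarith
          moreover have "real (nat \<lfloor>t\<rfloor>) \<le> t" "t \<le> real (Suc (nat \<lfloor>t\<rfloor>))" using t by linarith+
          ultimately show ?thesis using uv m0 unfolding p_def yt
            by (intro exI[of _ "nat \<lfloor>t\<rfloor>"]) (auto intro!: mult_right_mono divide_right_mono)
        qed
        then obtain k where k: "k < m" "p k \<le> y" "y \<le> p (Suc k)" by blast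
        have pk: "p k \<in> {u..v}" "p (Suc k) \<in> {u..v}" using p k(1) by auto
        have "p (Suc k) - p k < d" using step by (simp add: p_def distrib_right add_divide_distrib)
        then have "dist (p k) y < d" "dist (p (Suc k)) y < d"
          using k(2,3) by (auto simp: dist_real_def)
        then have "dist (g (p k)) (g y) < e / 2" "dist (g (p (Suc k))) (g y) < e / 2"
          using pk y d(2) by blast+
        moreover have "dist (F n (p k)) (g (p k)) < e / 2" "dist (F n (p (Suc k))) (g (p (Suc k))) < e / 2"
          using elim(2) k(1) by auto
        moreover have "F n (p k) \<le> F n y" "F n y \<le> F n (p (Suc k))"
          using mono_onD[OF elim(1)] k pk y by blast+
        ultimately show "dist (F n y) (g y) < e" unfolding dist_real_def by linarith
      qed
    qed
  qed
qed simp

text \<open>The filter at an endpoint ignores the endpoint itself. Limits taken inside the open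
  interval, where the rearrangement is an infimum, thus count as limits on the closed one.\<close>

lemma at_within_Icc_eq_Ioo:
  fixes y :: "'a :: order_topology"
  assumes "a < b" and "y \<in> {a..b}"
  shows "at y within {a..b} = at y within {a<..<b}"
proof -
  consider "y = a" | "y = b" | "a < y" "y < b" using assms(2) by fastforce
  then show ?thesis
  proof cases
    case 1
    then show ?thesis using assms(1) by (intro at_within_nhd[of _ "{..<b}"]) auto
  next
    case 2
    then show ?thesis using assms(1) by (intro at_within_nhd[of _ "{a<..}"]) auto
  next
    case 3
    then show ?thesis by (intro at_within_nhd[of _ "{a<..<b}"]) auto
  qed
qed

section \<open>Order statistics and splines\<close>

text \<open>If entry \<open>k\<close> were not below \<open>c\<close>, all entries below
  \<open>c\<close> would precede it, so there would be at most \<open>k\<close> of them.\<close>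

lemma sorted_nth_less:
  assumes "sorted s" and "k < length (filter (\<lambda>v. v < c) s)"
  shows "s ! k < c"
proof (rule ccontr)
  assume k: "\<not> s ! k < c"
  have "i < k" if "i < length s" "s ! i < c" for i
    using sorted_nth_mono[OF assms(1), of k i] that k by (meson leI le_less_trans)
  then have "{i. i < length s \<and> s ! i < c} \<subseteq> {..<k}" by auto
  then have "card {i. i < length s \<and> s ! i < c} \<le> k"
    using card_mono[of "{..<k}"] by simp
  then show False using assms(2) by (simp add: length_filter_conv_card)
qed

text \<open>Otherwise all entries above \<open>c\<close> would come after position \<open>k\<close>.
  The bound is stated additively to avoid truncated subtraction.\<close>

lemma sorted_nth_greater:
  assumes "sorted s" and "k < length s" and "length s < length (filter (\<lambda>v. c < v) s) + k + 1"
  shows "c < s ! k"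
proof (rule ccontr)
  assume k: "\<not> c < s ! k"
  have "k < i" if "i < length s" "c < s ! i" for i
    using sorted_nth_mono[OF assms(1), of i k] assms(2) that k by (meson leI less_le_trans)
  then have "{i. i < length s \<and> c < s ! i} \<subseteq> {k<..<length s}" by auto
  then have "card {i. i < length s \<and> c < s ! i} \<le> length s - Suc k"
    using card_mono[of "{k<..<length s}"] by simp
  then show False using assms(2,3) by (simp add: length_filter_conv_card)
qed

lemma sorted_sorted_samples: "sorted (sorted_samples \<Omega> f x n)"
  by (simp add: sorted_samples_def)

text \<open>Samples are counted by index, hence with multiplicity; this turns statements on order
  statistics into counts of grid points.\<close>

lemma length_filter_sorted_samples:
  "length (filter P (sorted_samples \<Omega> f x n)) = card (grid_indices {z \<in> \<Omega>. P (f z)} x n)"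
proof -
  have "length (filter P (sorted_samples \<Omega> f x n))
      = size (filter_mset P (mset (sorted_samples \<Omega> f x n)))"
    by (metis mset_filter size_mset)
  also have "\<dots> = size (filter_mset (\<lambda>i. P (f (x n i))) (mset_set (grid_indices \<Omega> x n)))"
    by (simp add: sorted_samples_def filter_mset_image_mset)
  also have "\<dots> = card {i \<in> grid_indices \<Omega> x n. P (f (x n i))}"
    by (simp add: filter_mset_mset_set)
  also have "{i \<in> grid_indices \<Omega> x n. P (f (x n i))} = grid_indices {z \<in> \<Omega>. P (f z)} x n"
    by (auto simp: grid_indices_def)
  finally show ?thesis .
qed

lemma length_sorted_samples: "length (sorted_samples \<Omega> f x n) = card (grid_indices \<Omega> x n)"
  using length_filter_sorted_samples[of "\<lambda>_. True" \<Omega> f x n] by simp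

lemma set_sorted_samples_subset: "set (sorted_samples \<Omega> f x n) \<subseteq> f ` \<Omega>"
proof -
  have "set (sorted_samples \<Omega> f x n) = (\<lambda>i. f (x n i)) ` grid_indices \<Omega> x n"
    by (simp add: sorted_samples_def)
  then show ?thesis by (auto simp: grid_indices_def)
qed

text \<open>Each piece has nonnegative slope because its end values are consecutive sorted entries;
  points of different pieces are compared through the nodes between them.\<close>

lemma is_linear_spline_mono_on:
  assumes g: "is_linear_spline m s g" and m: "m \<ge> 1" and s: "sorted s" "length s = m + 1"
  shows "mono_on {0..1} g"
proof (rule mono_onI)
  \<comment> \<open>The minimum with \<open>m - 1\<close> assigns \<open>y = 1\<close> to the last
    piece.\<close>
  define idx where "idx y = min (nat \<lfloor>y * real m\<rfloor>) (m - 1)" for y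
  define I where "I i = {real i / real m..real (i + 1) / real m}" for i
  have node: "g (real i / real m) = s ! i" if "i \<le> m" for i
    using g that by (simp add: is_linear_spline_def)
  have piece: "\<exists>p q. p \<ge> 0 \<and> (\<forall>y\<in>I i. g y = p * y + q)" if i: "i < m" for i
  proof -
    obtain p q where pq: "\<And>y. y \<in> I i \<Longrightarrow> g y = p * y + q"
      using g i unfolding is_linear_spline_def I_def by metis
    have ends: "real i / real m \<in> I i" "real (i + 1) / real m \<in> I i"
      using m by (simp_all add: I_def divide_right_mono)
    have "s ! i \<le> s ! (i + 1)" using s i by (simp add: sorted_nth_mono)
    then have "p * (real i / real m) \<le> p * (real (i + 1) / real m)"
      using node[of i] node[of "i + 1"] i pq[OF ends(1)] pq[OF ends(2)] by simp
    then have "0 \<le> p * (1 / real m)" by (simp add: distrib_left add_divide_distrib)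
    then have "0 \<le> p" using m by (simp add: zero_le_divide_iff)
    then show ?thesis using pq by blast
  qed
  have piece_mono: "g y \<le> g z" if "i < m" "y \<in> I i" "z \<in> I i" "y \<le> z" for i y z
    using piece[OF that(1)] that(2-4) by (metis add_right_mono mult_left_mono)
  have idx: "idx y < m" "y \<in> I (idx y)" if y: "y \<in> {0..1}" for y
  proof -
    show "idx y < m" using m by (auto simp: idx_def)
    have "0 \<le> y * real m" "y * real m \<le> real m" using y by (auto intro: mult_left_le_one_le)
    then have "real (idx y) \<le> y * real m" "y * real m \<le> real (idx y + 1)"
      using m unfolding idx_def by linarith+
    then show "y \<in> I (idx y)" using m by (simp add: I_def field_simps)
  qed
  fix y z :: real assume yz: "y \<in> {0..1}" "z \<in> {0..1}" "y \<le> z"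
  have "y * real m \<le> z * real m" using yz(3) by (simp add: mult_right_mono)
  then have le: "idx y \<le> idx z" unfolding idx_def by (intro min.mono nat_mono floor_mono) auto
  show "g y \<le> g z"
  proof (cases "idx y = idx z")
    case True
    then show ?thesis using piece_mono[of "idx z" y z] idx[OF yz(1)] idx[OF yz(2)] yz(3) by simp
  next
    case False
    have "g y \<le> g (real (idx y + 1) / real m)"
      using piece_mono[of "idx y"] idx[OF yz(1)] by (simp add: I_def divide_right_mono)
    also have "\<dots> = s ! (idx y + 1)" using node[of "idx y + 1"] idx(1)[OF yz(1)] by simp
    also have "\<dots> \<le> s ! idx z"
      using False le idx[OF yz(2)] s by (intro sorted_nth_mono) auto
    also have "\<dots> = g (real (idx z) / real m)" using node idx[OF yz(2)] by simp
    also have "\<dots> \<le> g z"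
      using piece_mono[of "idx z"] idx[OF yz(2)] by (simp add: I_def divide_right_mono)
    finally show ?thesis .
  qed
qed

section \<open>Convergence to the quantiles\<close>

text \<open>Continuity of \<open>f\<close> is a standing assumption because all four claims make it;
  one-sided bounds are added only where an endpoint is involved.\<close>

locale rearrangement_sampling =
  fixes \<Omega> :: "(real ^ 'd) set"
    and f :: "real ^ 'd \<Rightarrow> real"
    and a b :: "real ^ 'd"
    and x :: "nat ^ 'd \<Rightarrow> nat ^ 'd \<Rightarrow> real ^ 'd"
    and F :: "nat ^ 'd \<Rightarrow> real \<Rightarrow> real"
  assumes regular: "regular_set \<Omega>"
    and emeasure_pos: "emeasure lebesgue \<Omega> > 0"
    and connected: "connected \<Omega>"
    and subset_closure_interior: "\<Omega> \<subseteq> closure (interior \<Omega>)"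
    and a_le_b: "a \<le> b"
    and subset_cbox: "\<Omega> \<subseteq> cbox a b"
    and grid: "asymptotically_uniform_grid a b x"
    and spline: "\<And>n. omega \<Omega> x n \<ge> 1 \<Longrightarrow>
           is_linear_spline (omega \<Omega> x n) (sorted_samples \<Omega> f x n) (F n)"
    and cont: "continuous_on \<Omega> f"
begin

abbreviation mass :: "(real ^ 'd) set \<Rightarrow> real" where
  "mass \<equiv> measure lebesgue"

abbreviation ncard :: "(real ^ 'd) set \<Rightarrow> nat ^ 'd \<Rightarrow> real" where
  "ncard A n \<equiv> real (card (grid_indices A x n))"

lemma bounded: "bounded \<Omega>" and negligible_frontier: "negligible (frontier \<Omega>)"
  using regular by (auto simp: regular_set_def negligible_iff_null_sets)

lemma lmeasurable: "\<Omega> \<in> lmeasurable"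
  by (rule measurable_Jordan[OF bounded negligible_frontier])

lemma mass_pos: "0 < mass \<Omega>"
  using emeasure_pos lmeasurable by (simp add: emeasure_eq_measure2)

lemma content_pos: "0 < measure lborel (cbox a b)"
proof -
  have "mass \<Omega> \<le> mass (cbox a b)"
    using lmeasurable subset_cbox by (intro measure_mono_fmeasurable) auto
  then show ?thesis using mass_pos by simp
qed

text \<open>A degenerate side would give the rectangle, and with it \<Omega>, measure zero.\<close>

lemma a_less_b: "a $ j < b $ j"
proof -
  have "0 < (\<Prod>i\<in>UNIV. b $ i - a $ i)"
    using content_pos by (simp add: content_cbox_if_cart split: if_splits)
  then have "b $ j - a $ j \<noteq> 0" by (metis UNIV_I finite less_irrefl prod_zero)
  then show ?thesis using a_le_b by (simp add: less_eq_vec_def less_le)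
qed

section \<open>Measures of preimages\<close>

lemma lmeasurable_preimage:
  assumes "B \<in> sets borel"
  shows "{z \<in> \<Omega>. f z \<in> B} \<in> lmeasurable"
proof -
  have "f \<in> borel_measurable (lebesgue_on \<Omega>)"
    using cont lmeasurable by (simp add: continuous_imp_measurable_on_sets_lebesgue fmeasurableD)
  from measurable_sets[OF this assms] have "f -` B \<inter> \<Omega> \<in> sets (lebesgue_on \<Omega>)" by simp
  then have "f -` B \<inter> \<Omega> \<in> sets lebesgue"
    using lmeasurable by (simp add: sets_restrict_space_iff fmeasurableD)
  moreover have "f -` B \<inter> \<Omega> = {z \<in> \<Omega>. f z \<in> B}" by auto
  ultimately show ?thesis
    using bounded_subset[OF bounded] by (auto intro!: bounded_set_imp_lmeasurable)
qed

lemma lmeasurable_sublevel [simp]: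
  "{z \<in> \<Omega>. f z \<le> c} \<in> lmeasurable" "{z \<in> \<Omega>. f z < c} \<in> lmeasurable"
  "{z \<in> \<Omega>. c < f z} \<in> lmeasurable" "{z \<in> \<Omega>. c < f z \<and> f z < d} \<in> lmeasurable"
  using lmeasurable_preimage[of "{..c}"] lmeasurable_preimage[of "{..<c}"]
    lmeasurable_preimage[of "{c<..}"] lmeasurable_preimage[of "{c<..<d}"] by simp_all

lemma open_interior_preimage:
  assumes "open S"
  shows "open {z \<in> interior \<Omega>. f z \<in> S}"
proof -
  have "continuous_on (interior \<Omega>) f" using cont interior_subset continuous_on_subset by blast
  from continuous_open_preimage[OF this open_interior assms] show ?thesis
    by (simp add: vimage_def Int_def)
qed

text \<open>The two sets differ only within the negligible frontier. The left one is open in the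
  whole space, as the counting lemma requires.\<close>

lemma mass_interior_preimage:
  assumes "open S"
  shows "mass {z \<in> interior \<Omega>. f z \<in> S} = mass {z \<in> \<Omega>. f z \<in> S}"
proof -
  let ?A = "{z \<in> interior \<Omega>. f z \<in> S}" and ?N = "{z \<in> \<Omega> - interior \<Omega>. f z \<in> S}"
  have "?N \<subseteq> frontier \<Omega>" using closure_subset[of \<Omega>] by (auto simp: frontier_def)
  then have "negligible ?N" by (rule negligible_subset[OF negligible_frontier])
  then have "?N \<in> null_sets lebesgue" by (simp only: negligible_iff_null_sets)
  moreover have "?A \<in> sets lebesgue" using open_interior_preimage[OF assms] by (auto simp: borel_open)
  ultimately have "mass (?A \<union> ?N) = mass ?A" by (simp add: measure_Un_null_set)
  moreover have "?A \<union> ?N = {z \<in> \<Omega>. f z \<in> S}" using interior_subset by auto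
  ultimately show ?thesis by simp
qed

text \<open>The preimage is the trace of an open set \<open>T\<close>. As \<open>T\<close> contains
  a point of the closure of the interior, it meets the interior itself, in a nonempty open
  set.\<close>

lemma mass_preimage_pos:
  assumes "open S" and "z \<in> \<Omega>" and "f z \<in> S"
  shows "0 < mass {z \<in> \<Omega>. f z \<in> S}"
proof -
  obtain T where T: "open T" "{z \<in> \<Omega>. f z \<in> S} = \<Omega> \<inter> T"
    using continuous_openin_preimage_gen[OF cont assms(1)]
    by (auto simp: openin_open vimage_def Int_def)
  have "T \<inter> interior \<Omega> \<noteq> {}"
    using T assms subset_closure_interior open_Int_closure_eq_empty[of T "interior \<Omega>"] by blast
  then have ne: "{z \<in> interior \<Omega>. f z \<in> S} \<noteq> {}" using T(2) interior_subset by blast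
  have "{z \<in> interior \<Omega>. f z \<in> S} \<in> lmeasurable"
    using open_interior_preimage[OF assms(1)] interior_subset[of \<Omega>]
    by (intro lmeasurable_open bounded_subset[OF bounded]) auto
  then have "mass {z \<in> interior \<Omega>. f z \<in> S} \<noteq> 0"
    using open_not_negligible[OF open_interior_preimage[OF assms(1)] ne] negligible_iff_measure by blast
  then show ?thesis using mass_interior_preimage[OF assms(1)] by (simp add: zero_less_measure_iff)
qed

section \<open>Asymptotic shares of the grid points\<close>

text \<open>The complement of the closure receives its share of the grid points, and only the
  remaining ones can lie in \<Omega>. As the frontier is null, the closure has the same measure as
  \<Omega>.\<close>

lemma ncard_le:
  assumes "e > 0"
  shows "eventually (\<lambda>n. measure lborel (cbox a b) / real (card {1..n}) * ncard \<Omega> n < mass \<Omega> + e)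
           multi_at_top"
proof -
  let ?V = "- closure \<Omega>"
  have "closure \<Omega> \<subseteq> cbox a b" using subset_cbox closed_cbox closure_minimal by blast
  then have "mass (cbox a b - closure \<Omega>) = mass (cbox a b) - mass (closure \<Omega>)"
    by (intro measurable_measure_Diff) (auto simp: borel_closed)
  moreover have "?V \<inter> cbox a b = cbox a b - closure \<Omega>" by auto
  ultimately have "mass (?V \<inter> cbox a b) = measure lborel (cbox a b) - mass \<Omega>"
    using measure_closure[OF bounded negligible_frontier] by simp
  then have "eventually (\<lambda>n. measure lborel (cbox a b) - mass \<Omega> - e
      < measure lborel (cbox a b) / real (card {1..n}) * ncard ?V n) multi_at_top"
    using assms by (intro card_grid_indices_open_gt[OF grid a_less_b]) auto
  then show ?thesis
    using eventually_multi_at_top_component_ge[of 1]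
  proof eventually_elim
    case (elim n)
    have N: "0 < card {1..n}"
      using elim(2) by (auto simp: card_atLeastAtMost_one_vec prod_pos Suc_le_eq)
    have "grid_indices \<Omega> x n \<inter> grid_indices ?V x n = {}"
      using closure_subset by (auto simp: grid_indices_def)
    then have "card (grid_indices \<Omega> x n) + card (grid_indices ?V x n)
        = card (grid_indices \<Omega> x n \<union> grid_indices ?V x n)"
      by (simp add: card_Un_disjoint)
    also have "\<dots> \<le> card {1..n}" by (intro card_mono) (auto simp: grid_indices_def)
    finally have "ncard \<Omega> n + ncard ?V n \<le> real (card {1..n})" by linarith
    then have "measure lborel (cbox a b) / real (card {1..n}) * (ncard \<Omega> n + ncard ?V n)
        \<le> measure lborel (cbox a b) / real (card {1..n}) * real (card {1..n})"
      by (intro mult_left_mono) auto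
    also have "\<dots> = measure lborel (cbox a b)"
      using N by (metis nonzero_eq_divide_eq of_nat_0_less_iff less_irrefl)
    finally show ?case using elim(1) by (simp add: distrib_left)
  qed
qed

text \<open>Compares the lower bound for \<open>V\<close> with the upper bound for \<Omega>; the
  volume per grid point cancels.\<close>

lemma ncard_open_gt:
  assumes "open V" and "V \<subseteq> \<Omega>" and "0 \<le> r" and "r * mass \<Omega> < mass V"
  shows "eventually (\<lambda>n. r * ncard \<Omega> n < ncard V n) multi_at_top"
proof -
  \<comment> \<open>The gap in the assumption is split in two: one \<open>h\<close> is lost in the
    bound for \<open>V\<close>, the other pays for \<open>r * e\<close>. The \<open>+ 1\<close> in
    \<open>e\<close> keeps the denominator positive at \<open>r = 0\<close>.\<close>
  define h where "h = (mass V - r * mass \<Omega>) / 2"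
  define e where "e = h / (r + 1)"
  have h: "0 < h" using assms(4) by (simp add: h_def)
  then have e: "0 < e" using assms(3) by (simp add: e_def)
  have "V \<inter> cbox a b = V" using assms(2) subset_cbox by auto
  then have "eventually (\<lambda>n. r * mass \<Omega> + h
      < measure lborel (cbox a b) / real (card {1..n}) * ncard V n) multi_at_top"
    using h by (intro card_grid_indices_open_gt[OF grid a_less_b assms(1)]) (simp add: h_def field_simps)
  then show ?thesis
    using ncard_le[OF e] eventually_multi_at_top_component_ge[of 1]
  proof eventually_elim
    case (elim n)
    let ?w = "measure lborel (cbox a b) / real (card {1..n})"
    have w: "0 < ?w" using elim(3) content_pos
      by (auto simp: card_atLeastAtMost_one_vec prod_pos Suc_le_eq)
    have "r * (?w * ncard \<Omega> n) \<le> r * (mass \<Omega> + e)"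
      using elim(2) assms(3) by (intro mult_left_mono) auto
    also have "\<dots> \<le> r * mass \<Omega> + h"
    proof -
      have "r * e \<le> (r + 1) * e" using e by simp
      also have "\<dots> = h" using assms(3) by (simp add: e_def)
      finally show ?thesis by (simp add: distrib_left)
    qed
    also have "\<dots> < ?w * ncard V n" by (rule elim(1))
    finally have "?w * (r * ncard \<Omega> n) < ?w * ncard V n" by (simp add: mult_ac)
    then show ?case using w by (simp only: mult_less_cancel_left_pos)
  qed
qed

lemma ncard_preimage_gt:
  assumes "open S" and "0 \<le> r" and "r * mass \<Omega> < mass {z \<in> \<Omega>. f z \<in> S}"
  shows "eventually (\<lambda>n. r * ncard \<Omega> n < ncard {z \<in> \<Omega>. f z \<in> S} n) multi_at_top"
proof -
  let ?V = "{z \<in> interior \<Omega>. f z \<in> S}"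
  have "r * mass \<Omega> < mass ?V" using assms(3) by (simp only: mass_interior_preimage[OF assms(1)])
  then have "eventually (\<lambda>n. r * ncard \<Omega> n < ncard ?V n) multi_at_top"
    using assms(2) interior_subset[of \<Omega>]
    by (intro ncard_open_gt open_interior_preimage[OF assms(1)]) auto
  then show ?thesis
  proof eventually_elim
    case (elim n)
    have "card (grid_indices ?V x n) \<le> card (grid_indices {z \<in> \<Omega>. f z \<in> S} x n)"
      using interior_subset[of \<Omega>] by (intro card_mono finite_grid_indices) (auto simp: grid_indices_def)
    then show ?case using elim by linarith
  qed
qed

text \<open>The interior has the full measure of \<Omega>, so it receives a fixed positive fraction
  of a growing number of grid points.\<close>

lemma ncard_at_top: "eventually (\<lambda>n. K \<le> ncard \<Omega> n) multi_at_top"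
proof -
  define c where "c = mass \<Omega> / 2"
  have c: "0 < c" using mass_pos by (simp add: c_def)
  obtain N :: nat where N: "K * measure lborel (cbox a b) / c < real N"
    using reals_Archimedean2 by blast
  have "interior \<Omega> \<inter> cbox a b = interior \<Omega>" using subset_cbox interior_subset by blast
  then have "eventually (\<lambda>n. c < measure lborel (cbox a b) / real (card {1..n}) * ncard (interior \<Omega>) n)
      multi_at_top"
    using mass_pos measure_interior[OF bounded negligible_frontier]
    by (intro card_grid_indices_open_gt[OF grid a_less_b open_interior]) (simp add: c_def)
  then show ?thesis
    using eventually_multi_at_top_component_ge[of "max 1 N"]
  proof eventually_elim
    case (elim n)
    have n1: "1 \<le> n $ j" for j using elim(2) by simp
    \<comment> \<open>Any single coordinate bounds the product from below, since all factors are at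
      least 1.\<close>
    have "N \<le> n $ undefined" using elim(2) by simp
    also have "n $ undefined \<le> (\<Prod>j\<in>UNIV. n $ j)"
      using n1 by (intro dvd_imp_le dvd_prodI prod_pos) (auto simp: Suc_le_eq)
    finally have "N \<le> card {1..n}" by (simp add: card_atLeastAtMost_one_vec)
    then have "K * measure lborel (cbox a b) / c < real (card {1..n})" using N by linarith
    then have 1: "K * measure lborel (cbox a b) < c * real (card {1..n})"
      using c by (simp add: field_simps)
    have pos: "0 < card {1..n}"
      using n1 by (auto simp: card_atLeastAtMost_one_vec prod_pos Suc_le_eq)
    have "c * real (card {1..n}) < measure lborel (cbox a b) * ncard (interior \<Omega>) n"
      using elim(1) pos by (simp add: field_simps)
    with 1 have "K * measure lborel (cbox a b) < ncard (interior \<Omega>) n * measure lborel (cbox a b)"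
      by (simp add: mult.commute)
    then have "K < ncard (interior \<Omega>) n" using content_pos by simp
    moreover have "card (grid_indices (interior \<Omega>) x n) \<le> card (grid_indices \<Omega> x n)"
      using interior_subset[of \<Omega>] by (intro card_mono finite_grid_indices) (auto simp: grid_indices_def)
    ultimately show ?case by linarith
  qed
qed

lemma eventually_mono_on: "eventually (\<lambda>n. mono_on {0..1} (F n)) multi_at_top"
  using ncard_at_top[of 2]
proof eventually_elim
  case (elim n)
  then have "omega \<Omega> x n \<ge> 1" by (simp add: omega_def)
  moreover have "length (sorted_samples \<Omega> f x n) = omega \<Omega> x n + 1"
    using elim by (simp add: length_sorted_samples omega_def)
  ultimately show ?case
    using is_linear_spline_mono_on[OF spline] sorted_sorted_samples by blast
qed

section \<open>Splines against levels\<close>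

lemma spline_le_nth:
  assumes "omega \<Omega> x n \<ge> 1" and "mono_on {0..1} (F n)" and "y \<in> {0..1}"
    and "k \<le> omega \<Omega> x n" and "y * real (omega \<Omega> x n) \<le> real k"
  shows "F n y \<le> sorted_samples \<Omega> f x n ! k"
proof -
  have "y \<le> real k / real (omega \<Omega> x n)" using assms(1,5) by (simp add: pos_le_divide_eq)
  then have "F n y \<le> F n (real k / real (omega \<Omega> x n))"
    using assms by (intro mono_onD[OF assms(2)]) (auto simp: divide_le_eq)
  also have "\<dots> = sorted_samples \<Omega> f x n ! k"
    using spline[OF assms(1)] assms(4) by (simp add: is_linear_spline_def)
  finally show ?thesis .
qed

lemma nth_le_spline:
  assumes "omega \<Omega> x n \<ge> 1" and "mono_on {0..1} (F n)" and "y \<in> {0..1}"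
    and "k \<le> omega \<Omega> x n" and "real k \<le> y * real (omega \<Omega> x n)"
  shows "sorted_samples \<Omega> f x n ! k \<le> F n y"
proof -
  have "sorted_samples \<Omega> f x n ! k = F n (real k / real (omega \<Omega> x n))"
    using spline[OF assms(1)] assms(4) by (simp add: is_linear_spline_def)
  also have "real k / real (omega \<Omega> x n) \<le> y" using assms(1,5) by (simp add: pos_divide_le_eq)
  then have "F n (real k / real (omega \<Omega> x n)) \<le> F n y"
    using assms by (intro mono_onD[OF assms(2)]) (auto simp: divide_le_eq)
  finally show ?thesis .
qed

text \<open>The second alternatives cover the endpoints: for \<open>f\<close> bounded below, \<open>y = 0\<close> and \<open>c < Inf f\<close>, the
  first inequality of \<open>below_at\<close> degenerates to an equality; symmetrically for \<open>above_at\<close> at \<open>y = 1\<close>.\<close>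

definition below_at :: "real \<Rightarrow> real \<Rightarrow> bool" where
  "below_at c y \<longleftrightarrow> (1 - y) * mass \<Omega> < mass {z \<in> \<Omega>. c < f z} \<or> (\<forall>z\<in>\<Omega>. c < f z)"

definition above_at :: "real \<Rightarrow> real \<Rightarrow> bool" where
  "above_at c y \<longleftrightarrow> y * mass \<Omega> < mass {z \<in> \<Omega>. f z < c} \<or> (\<forall>z\<in>\<Omega>. f z < c)"

text \<open>With \<open>r\<close> strictly between \<open>y\<close> and the share of
  \<open>{f < c}\<close>, more than \<open>r * M\<close> of the \<open>M\<close> samples lie below
  \<open>c\<close>. The first node at or after \<open>y\<close> has an index \<open>k\<close>
  smaller than that, so its sample lies below \<open>c\<close> too.\<close>

lemma eventually_spline_less:
  assumes y: "y \<in> {0..1}" and "above_at c y"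
  shows "eventually (\<lambda>n. F n y < c) multi_at_top"
  using assms(2) unfolding above_at_def
proof
  assume "y * mass \<Omega> < mass {z \<in> \<Omega>. f z < c}"
  then have "y < mass {z \<in> \<Omega>. f z < c} / mass \<Omega>" using mass_pos by (simp add: pos_less_divide_eq)
  then obtain r where r: "y < r" "r * mass \<Omega> < mass {z \<in> \<Omega>. f z < c}"
    unfolding pos_less_divide_eq[OF mass_pos, symmetric] using dense by blast
  have "eventually (\<lambda>n. r * ncard \<Omega> n < ncard {z \<in> \<Omega>. f z \<in> {..<c}} n) multi_at_top"
    using r y by (intro ncard_preimage_gt) auto
  then show ?thesis
    \<comment> \<open>This many samples make \<open>(r - y) * M\<close> at least 1, which absorbs
      the rounding of \<open>k\<close>.\<close>
    using ncard_at_top[of "max 2 (1 / (r - y))"] eventually_mono_on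
  proof eventually_elim
    case (elim n)
    define M where "M = card (grid_indices \<Omega> x n)"
    define k where "k = nat \<lceil>y * real (omega \<Omega> x n)\<rceil>"
    have M: "2 \<le> M" "1 / (r - y) \<le> real M" using elim(2) by (simp_all add: M_def)
    have om: "omega \<Omega> x n = M - 1" by (simp add: omega_def M_def)
    have yk: "y * real (omega \<Omega> x n) \<le> real k" unfolding k_def by linarith
    have "y * real (omega \<Omega> x n) \<le> real (omega \<Omega> x n)" using y by (auto intro: mult_left_le_one_le)
    then have k_le: "k \<le> omega \<Omega> x n" by (simp add: k_def nat_le_iff ceiling_le_iff)
    have "0 \<le> y * real (omega \<Omega> x n)" using y by simp
    then have "real k < y * real (omega \<Omega> x n) + 1" unfolding k_def by linarith
    also have "y * real (omega \<Omega> x n) \<le> y * real M" using y by (intro mult_left_mono) (auto simp: om)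
    also have "y * real M + 1 \<le> r * real M"
      using M(2) r(1) by (simp add: field_simps)
    also have "r * real M < real (length (filter (\<lambda>v. v < c) (sorted_samples \<Omega> f x n)))"
      using elim(1) by (simp add: length_filter_sorted_samples M_def)
    finally have "sorted_samples \<Omega> f x n ! k < c"
      by (intro sorted_nth_less sorted_sorted_samples) simp
    moreover have "F n y \<le> sorted_samples \<Omega> f x n ! k"
      using M(1) om k_le yk y by (intro spline_le_nth elim(3)) auto
    ultimately show ?case by linarith
  qed
next
  \<comment> \<open>All samples lie below \<open>c\<close>; the last one bounds the spline even at
    \<open>y = 1\<close>.\<close>
  assume less: "\<forall>z\<in>\<Omega>. f z < c"
  show ?thesis
    using ncard_at_top[of 2] eventually_mono_on
  proof eventually_elim
    case (elim n)
    have om: "omega \<Omega> x n \<ge> 1" "omega \<Omega> x n < length (sorted_samples \<Omega> f x n)"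
      using elim(1) by (auto simp: omega_def length_sorted_samples)
    then have "sorted_samples \<Omega> f x n ! omega \<Omega> x n \<in> f ` \<Omega>"
      using set_sorted_samples_subset nth_mem by blast
    then have "sorted_samples \<Omega> f x n ! omega \<Omega> x n < c" using less by auto
    moreover have "F n y \<le> sorted_samples \<Omega> f x n ! omega \<Omega> x n"
      using om(1) y by (intro spline_le_nth elim(2)) (auto intro: mult_left_le_one_le)
    ultimately show ?case by linarith
  qed
qed

text \<open>Mirror image of the previous argument, with the last node at or before \<open>y\<close>
  and the samples above \<open>c\<close>.\<close>

lemma eventually_less_spline:
  assumes y: "y \<in> {0..1}" and "below_at c y"
  shows "eventually (\<lambda>n. c < F n y) multi_at_top"
  using assms(2) unfolding below_at_def
proof
  assume "(1 - y) * mass \<Omega> < mass {z \<in> \<Omega>. c < f z}"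
  then have "1 - y < mass {z \<in> \<Omega>. c < f z} / mass \<Omega>" using mass_pos by (simp add: pos_less_divide_eq)
  then obtain r where r: "1 - y < r" "r * mass \<Omega> < mass {z \<in> \<Omega>. c < f z}"
    unfolding pos_less_divide_eq[OF mass_pos, symmetric] using dense by blast
  have "eventually (\<lambda>n. r * ncard \<Omega> n < ncard {z \<in> \<Omega>. f z \<in> {c<..}} n) multi_at_top"
    using r y by (intro ncard_preimage_gt) auto
  then show ?thesis
    using ncard_at_top[of "max 2 (1 / (r - (1 - y)))"] eventually_mono_on
  proof eventually_elim
    case (elim n)
    define M where "M = card (grid_indices \<Omega> x n)"
    define k where "k = nat \<lfloor>y * real (omega \<Omega> x n)\<rfloor>"
    have M: "2 \<le> M" "1 / (r - (1 - y)) \<le> real M" using elim(2) by (simp_all add: M_def)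
    have om: "omega \<Omega> x n = M - 1" by (simp add: omega_def M_def)
    have nonneg: "0 \<le> y * real (omega \<Omega> x n)" using y by simp
    then have ky: "real k \<le> y * real (omega \<Omega> x n)" unfolding k_def by linarith
    have "y * real (omega \<Omega> x n) \<le> real (omega \<Omega> x n)" using y by (auto intro: mult_left_le_one_le)
    then have k_le: "k \<le> omega \<Omega> x n" using ky by linarith
    \<comment> \<open>There is one sample more than there are pieces, so \<open>y * M\<close>
      exceeds \<open>y * omega \<Omega> x n\<close> by \<open>y\<close>. This excess is at most 1
      and is absorbed by the slack in \<open>r\<close>; the 1 from rounding down is the one allowed
      by \<open>sorted_nth_greater\<close>.\<close>
    have "real M = (1 - y) * real M + y * real M" by (simp add: algebra_simps)
    also have "y * real M = y * real (omega \<Omega> x n) + y"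
      using M(1) by (simp add: om of_nat_diff algebra_simps)
    also have "y * real (omega \<Omega> x n) < real k + 1" unfolding k_def by linarith
    also have "(1 - y) * real M + (real k + 1 + y) \<le> (1 - y) * real M + 1 + real k + 1"
      using y by simp
    also have "(1 - y) * real M + 1 \<le> r * real M"
      using M(2) r(1) by (simp add: field_simps)
    also have "r * real M < real (length (filter (\<lambda>v. c < v) (sorted_samples \<Omega> f x n)))"
      using elim(1) by (simp add: length_filter_sorted_samples M_def)
    finally have "length (sorted_samples \<Omega> f x n)
        < length (filter (\<lambda>v. c < v) (sorted_samples \<Omega> f x n)) + k + 1"
      by (simp add: length_sorted_samples M_def)
    then have "c < sorted_samples \<Omega> f x n ! k"
      using k_le M(1) om
      by (intro sorted_nth_greater sorted_sorted_samples) (auto simp: length_sorted_samples M_def)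
    moreover have "sorted_samples \<Omega> f x n ! k \<le> F n y"
      using M(1) om k_le ky y by (intro nth_le_spline elim(3)) auto
    ultimately show ?case by linarith
  qed
next
  assume less: "\<forall>z\<in>\<Omega>. c < f z"
  show ?thesis
    using ncard_at_top[of 2] eventually_mono_on
  proof eventually_elim
    case (elim n)
    have om: "omega \<Omega> x n \<ge> 1" "0 < length (sorted_samples \<Omega> f x n)"
      using elim(1) by (auto simp: omega_def length_sorted_samples)
    then have "sorted_samples \<Omega> f x n ! 0 \<in> f ` \<Omega>"
      using set_sorted_samples_subset nth_mem by blast
    then have "c < sorted_samples \<Omega> f x n ! 0" using less by auto
    moreover have "sorted_samples \<Omega> f x n ! 0 \<le> F n y"
      using om(1) y by (intro nth_le_spline elim(2)) auto
    ultimately show ?case by linarith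
  qed
qed

section \<open>The rearrangement as a generalised inverse\<close>

abbreviation levels :: "real \<Rightarrow> real set" where
  "levels y \<equiv> {u. measure lebesgue {z \<in> \<Omega>. f z \<le> u} / measure lebesgue \<Omega> \<ge> y}"

lemma mem_levels: "u \<in> levels y \<longleftrightarrow> y * mass \<Omega> \<le> mass {z \<in> \<Omega>. f z \<le> u}"
  using mass_pos by (simp add: pos_le_divide_eq)

lemma mass_disjoint_Un:
  assumes "A \<in> lmeasurable" "B \<in> lmeasurable" "A \<inter> B = {}"
  shows "mass (A \<union> B) = mass A + mass B"
  using measure_Un3[OF assms(1,2)] assms(3) by simp

lemma mass_split: "mass {z \<in> \<Omega>. f z \<le> u} + mass {z \<in> \<Omega>. u < f z} = mass \<Omega>"
proof -
  have "mass ({z \<in> \<Omega>. f z \<le> u} \<union> {z \<in> \<Omega>. u < f z}) = mass {z \<in> \<Omega>. f z \<le> u} + mass {z \<in> \<Omega>. u < f z}"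
    by (intro mass_disjoint_Un) auto
  moreover have "{z \<in> \<Omega>. f z \<le> u} \<union> {z \<in> \<Omega>. u < f z} = \<Omega>" by auto
  ultimately show ?thesis by simp
qed

lemma mass_mono:
  assumes "A \<in> lmeasurable" "B \<in> lmeasurable" "A \<subseteq> B"
  shows "mass A \<le> mass B"
  using assms by (intro measure_mono_fmeasurable) (auto simp: fmeasurableD)

text \<open>Although \<open>f\<close> may be unbounded, it is bounded on a compact subset of nearly
  full measure, so its tails carry little mass.\<close>

lemma bounded_on_large_subset:
  assumes "r < 1"
  obtains B where "r * mass \<Omega> < mass {z \<in> \<Omega>. f z \<le> B}" "r * mass \<Omega> < mass {z \<in> \<Omega>. - B < f z}"
proof -
  have "r * mass \<Omega> < mass \<Omega>" using assms mass_pos by simp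
  then obtain K where K: "compact K" "K \<subseteq> \<Omega>" "r * mass \<Omega> < mass K"
    using lmeasurable_inner_compact[OF lmeasurable bounded] by blast
  have "compact (f ` K)" using K cont continuous_on_subset compact_continuous_image by blast
  then obtain B where B: "\<And>z. z \<in> K \<Longrightarrow> \<bar>f z\<bar> < B"
    using compact_imp_bounded bounded_pos_less[of "f ` K"] by auto
  have "mass K \<le> mass {z \<in> \<Omega>. f z \<le> B}" "mass K \<le> mass {z \<in> \<Omega>. - B < f z}"
    using K(1,2) B by (intro mass_mono lmeasurable_sublevel lmeasurable_compact; force)+
  then show ?thesis using that[of B] K(3) by linarith
qed

text \<open>Together with \<open>bdd_below_levels\<close> this makes the infimum defining the
  rearrangement a genuine one for \<open>y\<close> strictly between 0 and 1.\<close>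

lemma levels_nonempty:
  assumes "y < 1"
  shows "levels y \<noteq> {}"
proof -
  obtain B where "y * mass \<Omega> < mass {z \<in> \<Omega>. f z \<le> B}"
    using bounded_on_large_subset[OF assms] .
  then have "B \<in> levels y" unfolding mem_levels by (rule less_imp_le)
  then show ?thesis by blast
qed

lemma bdd_below_levels:
  assumes "0 < y"
  shows "bdd_below (levels y)"
proof -
  have "1 - y < 1" using assms by simp
  then obtain B where B: "(1 - y) * mass \<Omega> < mass {z \<in> \<Omega>. - B < f z}"
    by (rule bounded_on_large_subset)
  have "- B \<le> u" if "u \<in> levels y" for u
  proof (rule ccontr)
    assume "\<not> - B \<le> u"
    then have "mass {z \<in> \<Omega>. f z \<le> u} \<le> mass {z \<in> \<Omega>. f z \<le> - B}"
      by (intro mass_mono) auto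
    then show False using B that[unfolded mem_levels] mass_split[of "- B"] by (simp add: left_diff_distrib)
  qed
  then show ?thesis by (rule bdd_belowI)
qed

lemma rearr_open_le:
  assumes "0 < y" and "y * mass \<Omega> \<le> mass {z \<in> \<Omega>. f z \<le> u}"
  shows "rearr_open \<Omega> f y \<le> u"
  unfolding rearr_open_def using assms mem_levels by (intro cInf_lower bdd_below_levels) auto

text \<open>This and the next lemma transfer the share conditions to the rearrangement; they are
  what makes it continuous.\<close>

lemma rearr_open_le_if_above_at:
  assumes y: "0 < y" "y < 1" and c: "above_at c y"
  shows "rearr_open \<Omega> f y \<le> c"
proof (rule rearr_open_le[OF y(1)])
  have *: "mass {z \<in> \<Omega>. f z < c} \<le> mass {z \<in> \<Omega>. f z \<le> c}"
    by (intro mass_mono) auto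
  show "y * mass \<Omega> \<le> mass {z \<in> \<Omega>. f z \<le> c}"
    using c unfolding above_at_def
  proof
    assume "y * mass \<Omega> < mass {z \<in> \<Omega>. f z < c}"
    then show ?thesis using * by linarith
  next
    assume "\<forall>z\<in>\<Omega>. f z < c"
    then have "{z \<in> \<Omega>. f z \<le> c} = \<Omega>" by force
    then show ?thesis using y mass_pos by simp
  qed
qed

lemma le_rearr_open_if_below_at:
  assumes y: "0 < y" "y < 1" and c: "below_at c y"
  shows "c \<le> rearr_open \<Omega> f y"
  unfolding rearr_open_def
proof (rule cInf_greatest[OF levels_nonempty[OF y(2)]])
  fix u assume u: "u \<in> levels y"
  show "c \<le> u"
  proof (rule ccontr)
    assume "\<not> c \<le> u"
    then have less: "u < c" by simp
    have *: "mass {z \<in> \<Omega>. c < f z} \<le> mass {z \<in> \<Omega>. u < f z}"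
      using less by (intro mass_mono) auto
    show False
      using c unfolding below_at_def
    proof
      assume "(1 - y) * mass \<Omega> < mass {z \<in> \<Omega>. c < f z}"
      then show False using * u[unfolded mem_levels] mass_split[of u] by (simp add: left_diff_distrib)
    next
      assume "\<forall>z\<in>\<Omega>. c < f z"
      then have "{z \<in> \<Omega>. f z \<le> u} = {}" using less by force
      then have "y * mass \<Omega> \<le> 0" using u[unfolded mem_levels] by (simp only: measure_empty)
      then show False using y(1) mass_pos by (simp add: mult_le_0_iff)
    qed
  qed
qed

text \<open>A number below the infimum is not a level, so its sublevel set has share less than
  \<open>y\<close> and the complement more than \<open>1 - y\<close>.\<close>

lemma below_at_if_less_rearr_open:
  assumes "0 < y" and "c < rearr_open \<Omega> f y"
  shows "below_at c y"
proof -
  have "mass {z \<in> \<Omega>. f z \<le> c} < y * mass \<Omega>"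
    using rearr_open_le[OF assms(1), of c] assms(2) by linarith
  then show ?thesis using mass_split[of c] by (simp add: below_at_def left_diff_distrib)
qed

text \<open>The intermediate value theorem on the connected domain excludes plateaus of the distribution
  function, which would be jumps of the rearrangement.\<close>

lemma above_at_if_rearr_open_less:
  assumes y: "0 < y" "y < 1" and c: "rearr_open \<Omega> f y < c"
  shows "above_at c y"
proof -
  obtain u where u: "u \<in> levels y" "u < c"
    using cInf_lessD[OF levels_nonempty[OF y(2)] c[unfolded rearr_open_def]] by (elim bexE)
  show ?thesis
  proof (cases "\<forall>z\<in>\<Omega>. f z < c")
    case False
    then obtain z2 where z2: "z2 \<in> \<Omega>" "c \<le> f z2" by force
    have u': "y * mass \<Omega> \<le> mass {z \<in> \<Omega>. f z \<le> u}" using u(1) unfolding mem_levels .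
    have "0 < y * mass \<Omega>" using y(1) mass_pos by simp
    have "{z \<in> \<Omega>. f z \<le> u} \<noteq> {}"
    proof
      assume "{z \<in> \<Omega>. f z \<le> u} = {}"
      then have "mass {z \<in> \<Omega>. f z \<le> u} = 0" by (simp only: measure_empty)
      then show False using u' \<open>0 < y * mass \<Omega>\<close> by linarith
    qed
    then obtain z1 where z1: "z1 \<in> \<Omega>" "f z1 \<le> u" by blast
    have "connected (f ` \<Omega>)" using connected cont connected_continuous_image by blast
    \<comment> \<open>The midpoint lies strictly between \<open>u\<close> and \<open>c\<close>, so
      the open interval of values whose preimage is measured contains an attained value.\<close>
    moreover have "f z1 \<le> (u + c) / 2" "(u + c) / 2 \<le> f z2" using z1(2) z2(2) u(2) by auto
    ultimately have "(u + c) / 2 \<in> f ` \<Omega>"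
      using imageI[OF z1(1), of f] imageI[OF z2(1), of f] connectedD_interval by meson
    then obtain z where "z \<in> \<Omega>" "f z = (u + c) / 2" by force
    then have "0 < mass {z \<in> \<Omega>. f z \<in> {u<..<c}}"
      using u(2) by (intro mass_preimage_pos[of _ z]) auto
    then have pos: "0 < mass {z \<in> \<Omega>. u < f z \<and> f z < c}" by simp
    have "mass {z \<in> \<Omega>. f z \<le> u} + mass {z \<in> \<Omega>. u < f z \<and> f z < c}
        = mass ({z \<in> \<Omega>. f z \<le> u} \<union> {z \<in> \<Omega>. u < f z \<and> f z < c})"
      by (intro mass_disjoint_Un[symmetric]) auto
    also have "{z \<in> \<Omega>. f z \<le> u} \<union> {z \<in> \<Omega>. u < f z \<and> f z < c} = {z \<in> \<Omega>. f z < c}"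
      using u(2) by auto
    finally have "y * mass \<Omega> < mass {z \<in> \<Omega>. f z < c}" using pos u' by linarith
    then show ?thesis by (simp add: above_at_def)
  qed (simp add: above_at_def)
qed

section \<open>Convergence and continuity at quantiles\<close>

text \<open>A common interface for interior quantiles and the endpoint values \<open>Inf\<close> and
  \<open>Sup\<close>. Both the convergence of the splines and the continuity of the rearrangement
  are derived from it.\<close>

definition quantile_at :: "real \<Rightarrow> real \<Rightarrow> bool" where
  "quantile_at y q \<longleftrightarrow> (\<forall>c<q. below_at c y) \<and> (\<forall>c>q. above_at c y)"

lemma quantile_at_rearr_open: "0 < y \<Longrightarrow> y < 1 \<Longrightarrow> quantile_at y (rearr_open \<Omega> f y)"
  by (simp add: quantile_at_def below_at_if_less_rearr_open above_at_if_rearr_open_less)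

lemma nonempty: "\<Omega> \<noteq> {}"
  using mass_pos by auto

text \<open>Below the infimum the second alternative of \<open>below_at\<close> holds; above it some
  value is attained, and then on a set of positive measure.\<close>

lemma quantile_at_0:
  assumes "bdd_below (f ` \<Omega>)"
  shows "quantile_at 0 (Inf (f ` \<Omega>))"
  unfolding quantile_at_def
proof (intro conjI allI impI)
  fix c assume "c < Inf (f ` \<Omega>)"
  then show "below_at c 0"
    using cInf_lower[OF _ assms] unfolding below_at_def by (meson imageI less_le_trans)
next
  fix c assume "Inf (f ` \<Omega>) < c"
  then obtain z where "z \<in> \<Omega>" "f z < c" using cInf_lessD[of "f ` \<Omega>" c] nonempty by auto
  then have "0 < mass {z \<in> \<Omega>. f z \<in> {..<c}}" by (intro mass_preimage_pos[of _ z]) auto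
  then show "above_at c 0" by (simp add: above_at_def)
qed

lemma quantile_at_1:
  assumes "bdd_above (f ` \<Omega>)"
  shows "quantile_at 1 (Sup (f ` \<Omega>))"
  unfolding quantile_at_def
proof (intro conjI allI impI)
  fix c assume "Sup (f ` \<Omega>) < c"
  then show "above_at c 1"
    using cSup_upper[OF _ assms] unfolding above_at_def by (meson imageI le_less_trans)
next
  fix c assume "c < Sup (f ` \<Omega>)"
  then obtain z where "z \<in> \<Omega>" "c < f z" using less_cSupD[of "f ` \<Omega>" c] nonempty by auto
  then have "0 < mass {z \<in> \<Omega>. f z \<in> {c<..}}" by (intro mass_preimage_pos[of _ z]) auto
  then show "below_at c 1" by (simp add: below_at_def)
qed

lemma tendsto_spline:
  assumes "y \<in> {0..1}" and "quantile_at y q"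
  shows "((\<lambda>n. F n y) \<longlongrightarrow> q) multi_at_top"
  using assms eventually_spline_less eventually_less_spline
  by (intro order_tendstoI) (auto simp: quantile_at_def)

text \<open>The condition is open in \<open>y\<close>: one alternative is a strict inequality with a
  side continuous in \<open>y\<close>, the other does not involve \<open>y\<close>.\<close>

lemma eventually_below_at:
  assumes "below_at c y"
  shows "eventually (\<lambda>y'. below_at c y') (at y within S)"
  using assms unfolding below_at_def
proof
  assume *: "(1 - y) * mass \<Omega> < mass {z \<in> \<Omega>. c < f z}"
  have "((\<lambda>y'. (1 - y') * mass \<Omega>) \<longlongrightarrow> (1 - y) * mass \<Omega>) (at y within S)"
    by (intro tendsto_intros)
  from order_tendstoD(2)[OF this *]
  show "eventually (\<lambda>y'. (1 - y') * mass \<Omega> < mass {z \<in> \<Omega>. c < f z} \<or> (\<forall>z\<in>\<Omega>. c < f z)) (at y within S)"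
    by eventually_elim simp
qed simp

lemma eventually_above_at:
  assumes "above_at c y"
  shows "eventually (\<lambda>y'. above_at c y') (at y within S)"
  using assms unfolding above_at_def
proof
  assume *: "y * mass \<Omega> < mass {z \<in> \<Omega>. f z < c}"
  have "((\<lambda>y'. y' * mass \<Omega>) \<longlongrightarrow> y * mass \<Omega>) (at y within S)"
    by (intro tendsto_intros)
  from order_tendstoD(2)[OF this *]
  show "eventually (\<lambda>y'. y' * mass \<Omega> < mass {z \<in> \<Omega>. f z < c} \<or> (\<forall>z\<in>\<Omega>. f z < c)) (at y within S)"
    by eventually_elim simp
qed simp

lemma tendsto_rearr_open:
  assumes "quantile_at y q"
  shows "(rearr_open \<Omega> f \<longlongrightarrow> q) (at y within {0<..<1})"
proof (rule order_tendstoI)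
  have mem: "eventually (\<lambda>y'. y' \<in> {0<..<1}) (at y within {0<..<1})"
    by (simp add: eventually_at_filter)
  {
    fix c assume "c < q"
    \<comment> \<open>The share conditions give only weak bounds on the rearrangement; the
      intermediate \<open>d\<close> makes them strict.\<close>
    then obtain d where d: "c < d" "d < q" using dense by blast
    then have "below_at d y" using assms by (simp add: quantile_at_def)
    from eventually_below_at[OF this] mem
    show "eventually (\<lambda>y'. c < rearr_open \<Omega> f y') (at y within {0<..<1})"
    proof eventually_elim
      case (elim y')
      then show ?case using le_rearr_open_if_below_at[of y' d] d by simp
    qed
  next
    fix c assume "q < c"
    then obtain d where d: "q < d" "d < c" using dense by blast
    then have "above_at d y" using assms by (simp add: quantile_at_def)
    from eventually_above_at[OF this] mem
    show "eventually (\<lambda>y'. rearr_open \<Omega> f y' < c) (at y within {0<..<1})"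
    proof eventually_elim
      case (elim y')
      then show ?case using rearr_open_le_if_above_at[of y' d] d by simp
    qed
  }
qed

text \<open>Near 0 the filters \<open>at_right 0\<close> and \<open>at 0 within {0<..<1}\<close>
  agree, so the \<open>Lim\<close> in the definition exists and is the quantile at 0.\<close>

lemma monotone_rearrangement_0:
  assumes "bdd_below (f ` \<Omega>)"
  shows "monotone_rearrangement \<Omega> f 0 = Inf (f ` \<Omega>)"
  using tendsto_rearr_open[OF quantile_at_0[OF assms]]
  by (simp add: monotone_rearrangement_def at_within_Icc_at_right at_within_Icc_eq_Ioo[symmetric] tendsto_Lim)

lemma monotone_rearrangement_1:
  assumes "bdd_above (f ` \<Omega>)"
  shows "monotone_rearrangement \<Omega> f 1 = Sup (f ` \<Omega>)"
  using tendsto_rearr_open[OF quantile_at_1[OF assms]]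
  by (simp add: monotone_rearrangement_def at_within_Icc_at_left at_within_Icc_eq_Ioo[symmetric] tendsto_Lim)

lemma quantile_at_monotone_rearrangement:
  assumes "y \<in> {0..1}" and "y = 0 \<Longrightarrow> bdd_below (f ` \<Omega>)" and "y = 1 \<Longrightarrow> bdd_above (f ` \<Omega>)"
  shows "quantile_at y (monotone_rearrangement \<Omega> f y)"
proof -
  consider "y = 0" | "y = 1" | "0 < y" "y < 1" using assms(1) by fastforce
  then show ?thesis
  proof cases
    case 3
    then show ?thesis using quantile_at_rearr_open by (simp add: monotone_rearrangement_def)
  qed (use assms in \<open>simp_all add: monotone_rearrangement_0 quantile_at_0
        monotone_rearrangement_1 quantile_at_1\<close>)
qed

text \<open>A bound on \<open>f\<close> is demanded only if the interval contains the corresponding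
  endpoint, so all four claims are instances.\<close>

lemma uniform_limit_monotone_rearrangement:
  assumes sub: "{u..v} \<subseteq> {0..1}"
    and 0: "0 \<in> {u..v} \<Longrightarrow> bdd_below (f ` \<Omega>)" and 1: "1 \<in> {u..v} \<Longrightarrow> bdd_above (f ` \<Omega>)"
  shows "uniform_limit {u..v} F (monotone_rearrangement \<Omega> f) multi_at_top"
proof (rule uniform_limit_mono_on)
  have q: "quantile_at y (monotone_rearrangement \<Omega> f y)" if "y \<in> {u..v}" for y
    using that sub 0 1 by (intro quantile_at_monotone_rearrangement) auto
  show "eventually (\<lambda>n. mono_on {u..v} (F n)) multi_at_top"
    using eventually_mono_on by eventually_elim (use sub mono_on_subset in blast)
  show "((\<lambda>n. F n y) \<longlongrightarrow> monotone_rearrangement \<Omega> f y) multi_at_top" if "y \<in> {u..v}" for y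
    using that sub q[OF that] by (intro tendsto_spline) auto
  show "continuous_on {u..v} (monotone_rearrangement \<Omega> f)"
    unfolding continuous_on_def
  proof
    fix y assume y: "y \<in> {u..v}"
    \<comment> \<open>Inside the open interval the endpoint cases of the definition never occur, so
      the limit carries over to the extended function.\<close>
    have "eventually (\<lambda>y'. rearr_open \<Omega> f y' = monotone_rearrangement \<Omega> f y') (at y within {0<..<1})"
      by (simp add: eventually_at_filter monotone_rearrangement_def)
    with tendsto_rearr_open[OF q[OF y]]
    have "(monotone_rearrangement \<Omega> f \<longlongrightarrow> monotone_rearrangement \<Omega> f y) (at y within {0<..<1})"
      by (rule Lim_transform_eventually)
    then have "(monotone_rearrangement \<Omega> f \<longlongrightarrow> monotone_rearrangement \<Omega> f y) (at y within {0..1})"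
      using at_within_Icc_eq_Ioo[OF zero_less_one, of y] y sub by (metis subsetD)
    then show "(monotone_rearrangement \<Omega> f \<longlongrightarrow> monotone_rearrangement \<Omega> f y) (at y within {u..v})"
      using sub by (rule tendsto_within_subset)
  qed
qed

end

theorem theorem3p2:
  fixes \<Omega> :: "(real ^ 'd) set"
    and f :: "real ^ 'd \<Rightarrow> real"
    and a b :: "real ^ 'd"
    and x :: "nat ^ 'd \<Rightarrow> nat ^ 'd \<Rightarrow> real ^ 'd"
    and F :: "nat ^ 'd \<Rightarrow> real \<Rightarrow> real"
  assumes "regular_set \<Omega>"
    and "emeasure lebesgue \<Omega> > 0"
    and "connected \<Omega>"
    and "\<Omega> \<subseteq> closure (interior \<Omega>)"
    and "continuous_ae_on \<Omega> f"
    and "a \<le> b"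
    and "\<Omega> \<subseteq> cbox a b"
    and "asymptotically_uniform_grid a b x"
    and "\<And>n. omega \<Omega> x n \<ge> 1 \<Longrightarrow>
           is_linear_spline (omega \<Omega> x n) (sorted_samples \<Omega> f x n) (F n)"
  shows "(continuous_on \<Omega> f \<longrightarrow>
            (\<forall>\<alpha> \<beta>. 0 < \<alpha> \<and> \<alpha> \<le> \<beta> \<and> \<beta> < 1 \<longrightarrow>
               uniform_limit {\<alpha>..\<beta>} F (monotone_rearrangement \<Omega> f) multi_at_top))
       \<and> (continuous_on \<Omega> f \<and> bdd_below (f ` \<Omega>) \<longrightarrow>
            (\<forall>\<alpha>. 0 \<le> \<alpha> \<and> \<alpha> < 1 \<longrightarrow>
               uniform_limit {0..\<alpha>} F (monotone_rearrangement \<Omega> f) multi_at_top))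
       \<and> (continuous_on \<Omega> f \<and> bdd_above (f ` \<Omega>) \<longrightarrow>
            (\<forall>\<alpha>. 0 < \<alpha> \<and> \<alpha> \<le> 1 \<longrightarrow>
               uniform_limit {\<alpha>..1} F (monotone_rearrangement \<Omega> f) multi_at_top))
       \<and> (continuous_on \<Omega> f \<and> bounded (f ` \<Omega>) \<longrightarrow>
            uniform_limit {0..1} F (monotone_rearrangement \<Omega> f) multi_at_top)"
proof -
  have sampling: "rearrangement_sampling \<Omega> f a b x F" if "continuous_on \<Omega> f"
    using assms that by (simp add: rearrangement_sampling_def)
  note limit = rearrangement_sampling.uniform_limit_monotone_rearrangement[OF sampling]
  show ?thesis
    by (intro conjI impI allI; elim conjE; rule limit)
       (auto intro: bounded_imp_bdd_below bounded_imp_bdd_above)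
qed

end
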